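(* Define generalized harmonic numbers $H_n^{(k)}$ ($n\ge1$, $k\ge0$) by $H_n^{(0)}=1$ and $H_n^{(k)}=\sum_{j=1}^{n}H_j^{(k-1)}/j$ for $k\ge1$. Then for every positive integer $k$, $$\sum_{j=1}^{\infty}\frac{(-1)^{j-1}}{j^{k}}=\sum_{n=1}^{\infty}\frac{H_{n}^{(k-1)}}{n\,2^{n}},$$ and consequently, for every integer $k\ge2$, the Riemann zeta function satisfies $$\zeta(k)=\frac{2^{k-1}}{2^{k-1}-1}\sum_{n=1}^{\infty}\frac{H_{n}^{(k-1)}}{n\,2^{n}}.$$
   Context: $\zeta(k)=\sum_{j=1}^\infty j^{-k}$. *)

theory Defs
  imports "HOL-Analysis.Analysis"
begin

(* gen_harm k n is the number H_n^(k), used for n >= 1 only. *)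
fun gen_harm :: "nat \<Rightarrow> nat \<Rightarrow> real" where
  "gen_harm 0 n = 1"
| "gen_harm (Suc k) n = (\<Sum>j=1..n. gen_harm k j / real j)"

(* Meaningful for k >= 2, see zeta_nat_sums. *)
definition zeta_nat :: "nat \<Rightarrow> real" where
  "zeta_nat k = (\<Sum>j. 1 / real (Suc j) ^ k)"

lemma zeta_nat_sums:
  assumes "k \<ge> 2"
  shows "(\<lambda>j. 1 / real (Suc j) ^ k) sums zeta_nat k"
proof -
  have "summable (\<lambda>j. inverse (real (Suc j) ^ k))"
    using inverse_power_summable[OF assms, where ?'a = real]
    by (subst summable_Suc_iff[where f = "\<lambda>j. inverse (real j ^ k)"])
  then show ?thesis
    by (simp add: zeta_nat_def inverse_eq_divide summable_sums)
qed

end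

theory Submission
  imports Defs
begin

text \<open>
  The first identity is Euler's series transformation of the sequence \<open>1 / (m + 1) ^ k\<close>. Its
  signed iterated differences \<open>(\<Sum>i\<le>n. (-1) ^ i * (n choose i) / (m + i + 1) ^ k)\<close> satisfy, by
  writing \<open>n + m + 1 = (m + i + 1) + (n - i)\<close>, a recursion in \<open>k\<close> and \<open>n\<close> with nonnegative
  coefficients. It shows at once that they are nonnegative and that at \<open>m = 0\<close> they are
  generalized harmonic numbers.
\<close>

text \<open>Think of \<open>b n\<close> as the \<open>n\<close>-th row of a difference table. Its
  alternating sum \<open>T n\<close> is the mean of the leading entry \<open>b n 0\<close> and
  \<open>T (Suc n)\<close>; iterating this halves the remainder each time.\<close>

lemma euler_transform_sums:
  fixes b :: "nat \<Rightarrow> nat \<Rightarrow> real"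
  assumes nonneg: "\<And>n m. 0 \<le> b n m"
    and diff: "\<And>n m. b n m = b (Suc n) m + b n (Suc m)"
    and lim: "b 0 \<longlonglongrightarrow> 0"
  shows "summable (\<lambda>m. (-1) ^ m * b 0 m)"
    and "(\<lambda>n. b n 0 / 2 ^ Suc n) sums (\<Sum>m. (-1) ^ m * b 0 m)"
proof -
  define T where "T n = (\<Sum>m. (-1) ^ m * b n m)" for n
  have le: "b (Suc n) m \<le> b n m" "b n (Suc m) \<le> b n m" for n m
    using diff[of n m] nonneg[of n "Suc m"] nonneg[of "Suc n" m] by linarith+
  have le0: "b n m \<le> b 0 m" for n m
    by (induction n) (use le(1) order_trans in blast)+
  have lim_n: "b n \<longlonglongrightarrow> 0" for n
    by (rule tendsto_sandwich[OF _ _ tendsto_const lim]) (simp_all add: nonneg le0)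
  have mono: "monoseq (b n)" for n
    by (simp add: monoseq_Suc le)
  have summ: "summable (\<lambda>m. (-1) ^ m * b n m)" for n
    by (rule summable_Leibniz(1)[OF lim_n mono])
  \<comment> \<open>An alternating series with decreasing terms lies between its partial sums of
    zero terms and of one term.\<close>
  have bounds: "0 \<le> T n \<and> T n \<le> b n 0" for n
    using summable_Leibniz'(2)[OF lim_n nonneg le(2), of n 0]
      summable_Leibniz'(4)[OF lim_n nonneg le(2), of n 0]
    by (simp add: T_def)
  have step: "T n = b n 0 / 2 + T (Suc n) / 2" for n
  proof -
    have "T n = b n 0 + (\<Sum>m. (-1) ^ Suc m * b n (Suc m))"
      using suminf_split_head[OF summ[of n]] by (simp add: T_def)
    \<comment> \<open>Replacing \<open>b n (Suc m)\<close> by \<open>b n m - b (Suc n) m\<close>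
      makes \<open>T n\<close> reappear on the right, hence the factor 1/2.\<close>
    also have "(\<lambda>m. (-1) ^ Suc m * b n (Suc m)) = (\<lambda>m. (-1) ^ m * b (Suc n) m - (-1) ^ m * b n m)"
      by (subst (2) diff) (simp add: algebra_simps)
    also have "suminf \<dots> = T (Suc n) - T n"
      by (simp add: T_def suminf_diff[OF summ summ])
    finally show ?thesis by simp
  qed
  have partial: "(\<Sum>n<N. b n 0 / 2 ^ Suc n) = T 0 - T N / 2 ^ N" for N
  proof (induction N)
    case (Suc N)
    then show ?case using step[of N] by (simp add: field_simps)
  qed simp
  have "(\<lambda>N. T N / 2 ^ N) \<longlonglongrightarrow> 0"
  proof (rule tendsto_sandwich[OF _ _ tendsto_const])
    show "\<forall>\<^sub>F N in sequentially. 0 \<le> T N / 2 ^ N"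
      by (simp add: bounds)
    show "\<forall>\<^sub>F N in sequentially. T N / 2 ^ N \<le> b 0 0 * (1 / 2) ^ N"
      using bounds le0[of _ 0]
      by (auto simp: power_divide divide_simps intro!: always_eventually intro: order_trans)
    show "(\<lambda>N. b 0 0 * (1 / 2) ^ N) \<longlonglongrightarrow> 0"
      by (intro tendsto_mult_right_zero LIMSEQ_realpow_zero) auto
  qed
  then have "(\<lambda>N. T 0 - T N / 2 ^ N) \<longlonglongrightarrow> T 0 - 0"
    by (intro tendsto_diff tendsto_const)
  then show "(\<lambda>n. b n 0 / 2 ^ Suc n) sums (\<Sum>m. (-1) ^ m * b 0 m)"
    unfolding sums_def partial by (simp add: T_def)
  show "summable (\<lambda>m. (-1) ^ m * b 0 m)"
    by (rule summ)
qed

text \<open>\<open>pow_diff k n m\<close> is the \<open>n\<close>-th signed difference of \<open>1 / (m + 1) ^ k\<close> at \<open>m\<close>.\<close>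
fun pow_diff :: "nat \<Rightarrow> nat \<Rightarrow> nat \<Rightarrow> real" where
  "pow_diff 0 n m = (if n = 0 then 1 else 0)"
| "pow_diff (Suc k) 0 m = pow_diff k 0 m / real (m + 1)"
| "pow_diff (Suc k) (Suc n) m =
    (pow_diff k (Suc n) m + real (Suc n) * pow_diff (Suc k) n m) / real (n + m + 2)"

lemma pow_diff_0: "pow_diff k 0 m = 1 / real (Suc m) ^ k"
  by (induction k) (simp_all add: mult.commute)

lemma pow_diff_nonneg: "0 \<le> pow_diff k n m"
  by (induction k n m rule: pow_diff.induct) simp_all

text \<open>The defining recursion keeps \<open>m\<close> fixed, so the difference-table property
  needs a proof: induction on \<open>k\<close>, and within it on \<open>n\<close>, with the
  denominators cleared.\<close>

lemma pow_diff_rec: "pow_diff k n m = pow_diff k (Suc n) m + pow_diff k n (Suc m)"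
proof (induction k arbitrary: n)
  case (Suc k)
  note outer = Suc.IH
  show ?case
  proof (induction n)
    case 0
    have "pow_diff (Suc k) (Suc 0) m + pow_diff (Suc k) 0 (Suc m) =
        (pow_diff k 0 m + pow_diff k 0 m / real (m + 1)) / real (m + 2)"
      by (subst (1) outer[of 0]) (simp add: add_divide_distrib)
    also have "\<dots> = pow_diff (Suc k) 0 m"
      by (simp add: divide_simps) (simp add: algebra_simps)
    finally show ?case by simp
  next
    case (Suc n)
    define x y z where "x = pow_diff (Suc k) (Suc n) m"
      and "y = pow_diff (Suc k) (Suc n) (Suc m)" and "z = pow_diff (Suc k) (Suc (Suc n)) m"
    have x: "real (n + m + 2) * x = pow_diff k (Suc n) m + real (Suc n) * pow_diff (Suc k) n m"
      by (simp add: x_def)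
    have y: "real (n + m + 3) * y =
        pow_diff k (Suc n) (Suc m) + real (Suc n) * pow_diff (Suc k) n (Suc m)"
      by (simp add: y_def add_ac)
    have z: "real (n + m + 3) * z = pow_diff k (Suc (Suc n)) m + real (n + 2) * x"
      by (simp add: x_def z_def add_ac)
    have IH: "pow_diff (Suc k) n m = x + pow_diff (Suc k) n (Suc m)"
      using Suc.IH by (simp only: x_def)
    \<comment> \<open>The outer hypothesis evaluates the difference of the level-\<open>k\<close>
      terms, the inner one that of the terms with factor \<open>Suc n\<close>. Adding
      \<open>x\<close> to both sides then gives the right-hand side of \<open>z\<close>.\<close>
    have "real (n + m + 2) * x - real (n + m + 3) * y =
        pow_diff k (Suc (Suc n)) m + real (Suc n) * x"
      unfolding x y using outer[of "Suc n"] IH by (simp add: algebra_simps)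
    then have "real (n + m + 3) * x = real (n + m + 3) * (z + y)"
      using z by (simp add: algebra_simps)
    then show ?case
      unfolding x_def[symmetric] y_def[symmetric] z_def[symmetric] by simp
  qed
qed simp

text \<open>At \<open>m = 0\<close>, passing from \<open>n\<close> to \<open>Suc n\<close> increases
  \<open>real (Suc n) * pow_diff (Suc k) n 0\<close> by \<open>pow_diff k (Suc n) 0\<close>. For
  positive \<open>k\<close> this is the next summand of \<open>gen_harm k\<close>; for
  \<open>k = 0\<close> it is 0 and the product stays 1.\<close>

lemma pow_diff_gen_harm: "pow_diff (Suc k) n 0 = gen_harm k (Suc n) / real (Suc n)"
proof (induction k arbitrary: n)
  case 0
  show ?case by (induction n) simp_all
next
  case (Suc k)
  note outer = Suc.IH
  show ?case
  proof (induction n)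
    case 0
    show ?case using outer[of 0] by simp
  next
    case (Suc n)
    have "pow_diff (Suc (Suc k)) (Suc n) 0 =
        (gen_harm k (Suc (Suc n)) / real (Suc (Suc n)) + gen_harm (Suc k) (Suc n)) / real (n + 2)"
      by (simp only: pow_diff.simps(3)[of "Suc k"] outer Suc.IH) simp
    then show ?case by (simp add: add.commute)
  qed
qed

lemma tendsto_inverse_power_Suc:
  assumes "k \<ge> 1"
  shows "(\<lambda>m. 1 / real (Suc m) ^ k) \<longlonglongrightarrow> 0"
proof -
  have "(\<lambda>m. inverse (real (Suc m)) ^ k) \<longlonglongrightarrow> 0 ^ k"
    by (intro tendsto_power LIMSEQ_inverse_real_of_nat)
  then show ?thesis
    using assms by (simp add: inverse_eq_divide power_one_over power_0_left del: of_nat_Suc)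
qed

lemma eta_gen_harm:
  assumes "k \<ge> 1"
  shows "summable (\<lambda>j. (-1) ^ j / real (Suc j) ^ k)"
    and "(\<lambda>n. gen_harm (k - 1) (Suc n) / (real (Suc n) * 2 ^ Suc n)) sums
      (\<Sum>j. (-1) ^ j / real (Suc j) ^ k)"
proof -
  have lim: "pow_diff k 0 \<longlonglongrightarrow> 0"
    using tendsto_inverse_power_Suc[OF assms] unfolding pow_diff_0[abs_def] .
  have eq: "pow_diff k n 0 = gen_harm (k - 1) (Suc n) / real (Suc n)" for n
    using pow_diff_gen_harm[of "k - 1" n] assms by simp
  note euler = euler_transform_sums[where b = "pow_diff k", OF pow_diff_nonneg pow_diff_rec lim]
  show "summable (\<lambda>j. (-1) ^ j / real (Suc j) ^ k)"
    using euler(1) by (simp add: pow_diff_0)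
  show "(\<lambda>n. gen_harm (k - 1) (Suc n) / (real (Suc n) * 2 ^ Suc n)) sums
      (\<Sum>j. (-1) ^ j / real (Suc j) ^ k)"
    using euler(2) by (simp only: eq pow_diff_0 divide_divide_eq_left times_divide_eq_right mult_1_right)
qed

text \<open>Subtracting the alternating series from the zeta series leaves twice the terms with even
  base, which sum to \<open>2 / 2 ^ k\<close> times zeta.\<close>

lemma eta_zeta_nat:
  assumes "k \<ge> 2"
  shows "(\<Sum>j. (-1) ^ j / real (Suc j) ^ k) = (1 - 1 / 2 ^ (k - 1)) * zeta_nat k"
proof -
  define f where "f j = 1 / real (Suc j) ^ k - (-1) ^ j / real (Suc j) ^ k" for j
  have "f sums (zeta_nat k - (\<Sum>j. (-1) ^ j / real (Suc j) ^ k))"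
    unfolding f_def
    by (intro sums_diff zeta_nat_sums summable_sums eta_gen_harm(1)) (use assms in auto)
  moreover have "f sums (1 / 2 ^ (k - 1) * zeta_nat k)"
  proof -
    \<comment> \<open>Indices start at 0, so the even bases \<open>2 * Suc i\<close> sit at the odd
      indices \<open>2 * i + 1\<close>; \<open>f\<close> vanishes elsewhere.\<close>
    have "(\<lambda>i. f (2 * i + 1)) = (\<lambda>i. 1 / 2 ^ (k - 1) * (1 / real (Suc i) ^ k))"
    proof
      fix i
      have "real (Suc (2 * i + 1)) ^ k = 2 * 2 ^ (k - 1) * real (Suc i) ^ k"
        using assms by (simp flip: power_Suc power_mult_distrib add: algebra_simps)
      then show "f (2 * i + 1) = 1 / 2 ^ (k - 1) * (1 / real (Suc i) ^ k)"
        unfolding f_def by simp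
    qed
    then have "(\<lambda>i. f (2 * i + 1)) sums (1 / 2 ^ (k - 1) * zeta_nat k)"
      using sums_mult[OF zeta_nat_sums[OF assms], of "1 / 2 ^ (k - 1)"] by (simp only:)
    moreover have "f j = 0" if "j \<notin> range (\<lambda>i. 2 * i + 1)" for j
    proof -
      have "even j" using that by (metis oddE rangeI)
      then show ?thesis by (simp add: f_def)
    qed
    ultimately show ?thesis
      using sums_mono_reindex[of "\<lambda>i. 2 * i + 1" f] by (simp add: strict_mono_def)
  qed
  ultimately have "zeta_nat k - (\<Sum>j. (-1) ^ j / real (Suc j) ^ k) = 1 / 2 ^ (k - 1) * zeta_nat k"
    by (rule sums_unique2)
  then show ?thesis by (simp add: algebra_simps)
qed

theorem theorem1:
  "(\<forall>k::nat. k \<ge> 1 \<longrightarrow>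
      summable (\<lambda>j. (-1) ^ j / real (Suc j) ^ k) \<and>
      summable (\<lambda>n. gen_harm (k - 1) (Suc n) / (real (Suc n) * 2 ^ Suc n)) \<and>
      (\<Sum>j. (-1) ^ j / real (Suc j) ^ k) =
      (\<Sum>n. gen_harm (k - 1) (Suc n) / (real (Suc n) * 2 ^ Suc n))) \<and>
   (\<forall>k::nat. k \<ge> 2 \<longrightarrow>
      zeta_nat k = 2 ^ (k - 1) / (2 ^ (k - 1) - 1) *
        (\<Sum>n. gen_harm (k - 1) (Suc n) / (real (Suc n) * 2 ^ Suc n)))"
proof (intro conjI allI impI)
  fix k :: nat
  assume k: "k \<ge> 1"
  show "summable (\<lambda>j. (-1) ^ j / real (Suc j) ^ k)"
    by (rule eta_gen_harm(1)[OF k])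
  show "summable (\<lambda>n. gen_harm (k - 1) (Suc n) / (real (Suc n) * 2 ^ Suc n))"
    by (rule sums_summable[OF eta_gen_harm(2)[OF k]])
  show "(\<Sum>j. (-1) ^ j / real (Suc j) ^ k) =
      (\<Sum>n. gen_harm (k - 1) (Suc n) / (real (Suc n) * 2 ^ Suc n))"
    by (rule sums_unique[OF eta_gen_harm(2)[OF k]])
next
  fix k :: nat
  assume k: "k \<ge> 2"
  have "(\<Sum>n. gen_harm (k - 1) (Suc n) / (real (Suc n) * 2 ^ Suc n)) =
      (1 - 1 / 2 ^ (k - 1)) * zeta_nat k"
    using sums_unique[OF eta_gen_harm(2)] eta_zeta_nat[OF k] k by simp
  \<comment> \<open>This makes \<open>2 ^ (k - 1) - 1\<close> nonzero, so that the identity can be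
    solved for \<open>zeta_nat k\<close>.\<close>
  moreover have "(1::real) < 2 ^ (k - 1)"
    using k by (intro one_less_power) auto
  ultimately show "zeta_nat k = 2 ^ (k - 1) / (2 ^ (k - 1) - 1) *
      (\<Sum>n. gen_harm (k - 1) (Suc n) / (real (Suc n) * 2 ^ Suc n))"
    by (simp only:) (simp add: divide_simps)
qed

end
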